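(* Let $\Omega\subseteq\mathbb{R}^d$ be open with $\mu(\Omega)<\infty$ and let $p(\cdot)\in\mathcal{P}$ with $1<p_-\le p_+<\infty$. If there exists $x_0\in\Omega$ such that $p(x_0)=p_-$ and $p(\cdot)\in LH_0\{x_0\}$, then the growth envelope of the variable Lebesgue space is $$\mathfrak{E}_{\mathsf G}(L_{p(\cdot)}(\Omega))=\left(t^{-1/p_-},\ p_-\right).$$
   Context: $\mu$ is Lebesgue measure on $\Omega$. For a measurable $p(\cdot):\Omega\to(0,\infty)$ put $p_-=\operatorname{ess\,inf}_{x\in\Omega}p(x)$, $p_+=\operatorname{ess\,sup}_{x\in\Omega}p(x)$. $\mathcal{P}$ is the set of such functions with $p_->0$ (exponent functions). Log-Hölder continuity: $r(\cdot)\in LH_0\{x_0\}$ (locally log-Hölder continuous at $x_0\in\Omega$) if there is $C_0>0$ with $|r(x)-r(x_0)|\le\frac{C_0}{-\log(|x-x_0|)}$ for all $x\in\Omega$ with $|x-x_0|<1/2$. Variable Lebesgue space $L_{p(\cdot)}(\Omega)$: with $\varrho_{p(\cdot)}(f)=\int_\Omega|f(x)|^{p(x)}\,dx$, it consists of the measurable $f$ with $\varrho_{p(\cdot)}(f/\lambda)<\infty$ for some $\lambda>0$, with quasi-norm $\|f\|_{p(\cdot)}=\inf\{\lambda>0:\varrho_{p(\cdot)}(f/\lambda)\le1\}$. Rearrangement: $f^*(t)=\inf\{s>0:\mu(\{|f|>s\})\le t\}$, $t\ge0$ (with $\inf\emptyset=\infty$). Growth envelope: for a quasi-normed function space $X$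 on $\Omega$, $\mathcal{E}_{\mathsf G}^X(t)=\sup\{f^*(t):\|f\|_X\le1\}$, $t>0$. Growth envelope functions are considered up to equivalence near $0$. For a positive, decreasing, continuously differentiable function $\Psi$ and $u\in(0,\infty]$, the equality $\mathfrak{E}_{\mathsf G}(X)=(\Psi(t),u)$ means: (i) there are $\varepsilon>0$ and constants $A,B>0$ with $A\,\Psi(t)\le\mathcal{E}_{\mathsf G}^X(t)\le B\,\Psi(t)$ for $0<t<\varepsilon$; and (ii) $u$ is the infimum of all $0<v\le\infty$ for which, for some $c>0$ and a fixed sufficiently small $\varepsilon>0$, $$\left(-\int_0^\varepsilon\left(\frac{f^*(t)}{\Psi(t)}\right)^v\frac{\Psi'(t)}{\Psi(t)}\,dt\right)^{1/v}\le c\,\|f\|_X\quad\text{for all }f\in X$$ (for $v=\infty$: $\sup_{0<t<\varepsilon}f^*(t)/\Psi(t)\le c\|f\|_X$). For $\Psi(t)=t^{-1/r}$ the measure $-\frac{\Psi'(t)}{\Psi(t)}dt$ is a constant multiple of $\frac{dt}{t}$. *)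

theory Defs
  imports "HOL-Analysis.Analysis" "HOL-Probability.Essential_Supremum"
begin

text \<open>
  A function on \<open>\<Omega>\<close> is represented by a total function whose values outside \<open>\<Omega>\<close> are
  irrelevant: everything below is evaluated over the measure space \<open>lebesgue_on \<Omega>\<close> or over
  points of \<open>\<Omega>\<close> only. Elements of function spaces take values in \<open>'b::real_normed_field\<close>,
  which covers real-valued and complex-valued functions simultaneously.
\<close>

subsection \<open>Exponent functions\<close>

definition essinf :: "'a measure \<Rightarrow> ('a \<Rightarrow> 'c::complete_lattice) \<Rightarrow> 'c" where
  "essinf M f = Sup {z. AE x in M. z \<le> f x}"

definition p_minus :: "'a::euclidean_space set \<Rightarrow> ('a \<Rightarrow> real) \<Rightarrow> ereal" where
  "p_minus \<Omega> p = essinf (lebesgue_on \<Omega>) (\<lambda>x. ereal (p x))"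

definition p_plus :: "'a::euclidean_space set \<Rightarrow> ('a \<Rightarrow> real) \<Rightarrow> ereal" where
  "p_plus \<Omega> p = esssup (lebesgue_on \<Omega>) (\<lambda>x. ereal (p x))"

definition exponent_functions :: "'a::euclidean_space set \<Rightarrow> ('a \<Rightarrow> real) set" where
  "exponent_functions \<Omega> =
     {p. p \<in> borel_measurable (lebesgue_on \<Omega>) \<and> (\<forall>x\<in>\<Omega>. 0 < p x) \<and> 0 < p_minus \<Omega> p}"

text \<open>
  At \<open>x = x\<^sub>0\<close> the condition reads \<open>0 \<le> C / - ln 0\<close>; it holds in HOL because
  \<open>ln 0 = 0\<close> and \<open>C / 0 = 0\<close>, so this point imposes nothing.
\<close>

definition LH0 :: "'a::euclidean_space set \<Rightarrow> 'a \<Rightarrow> ('a \<Rightarrow> real) set" where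
  "LH0 \<Omega> x\<^sub>0 = {r. \<exists>C>0. \<forall>x\<in>\<Omega>. norm (x - x\<^sub>0) < 1 / 2 \<longrightarrow>
                  \<bar>r x - r x\<^sub>0\<bar> \<le> C / (- ln (norm (x - x\<^sub>0)))}"

subsection \<open>Variable Lebesgue spaces\<close>

definition modular ::
  "'a::euclidean_space set \<Rightarrow> ('a \<Rightarrow> real) \<Rightarrow> ('a \<Rightarrow> 'b::real_normed_field) \<Rightarrow> ennreal" where
  "modular \<Omega> p f = (\<integral>\<^sup>+ x. ennreal (norm (f x) powr p x) \<partial>lebesgue_on \<Omega>)"

definition Lvar ::
  "'a::euclidean_space set \<Rightarrow> ('a \<Rightarrow> real) \<Rightarrow> ('a \<Rightarrow> 'b::real_normed_field) set" where
  "Lvar \<Omega> p = {f. f \<in> borel_measurable (lebesgue_on \<Omega>) \<and>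
                  (\<exists>l>0. modular \<Omega> p (\<lambda>x. f x /\<^sub>R l) < \<infinity>)}"

definition Lvar_norm ::
  "'a::euclidean_space set \<Rightarrow> ('a \<Rightarrow> real) \<Rightarrow> ('a \<Rightarrow> 'b::real_normed_field) \<Rightarrow> ennreal" where
  "Lvar_norm \<Omega> p f = (INF l\<in>{l. 0 < l \<and> modular \<Omega> p (\<lambda>x. f x /\<^sub>R l) \<le> 1}. ennreal l)"

subsection \<open>Growth envelopes\<close>

definition rearrangement ::
  "'a measure \<Rightarrow> ('a \<Rightarrow> 'b::real_normed_field) \<Rightarrow> real \<Rightarrow> ennreal" where
  "rearrangement M f t =
     (INF s\<in>{s. 0 < s \<and> emeasure M {x \<in> space M. s < norm (f x)} \<le> ennreal t}. ennreal s)"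

text \<open>A quasi-normed function space is given by its carrier \<open>X\<close> and its quasi-norm \<open>N\<close>.\<close>

definition growth_envelope_function ::
  "'a measure \<Rightarrow> ('a \<Rightarrow> 'b::real_normed_field) set \<Rightarrow> (('a \<Rightarrow> 'b) \<Rightarrow> ennreal) \<Rightarrow> real \<Rightarrow> ennreal"
  where
  "growth_envelope_function M X N t = (SUP f\<in>{f \<in> X. N f \<le> 1}. rearrangement M f t)"

text \<open>Real powers of extended nonnegative reals, intended for exponents \<open>a > 0\<close>.\<close>

definition ennreal_powr :: "ennreal \<Rightarrow> real \<Rightarrow> ennreal" where
  "ennreal_powr x a = (if x = \<infinity> then \<infinity> else ennreal (enn2real x powr a))"

text \<open>
  The left-hand side of the inequality defining the fine index. For decreasing positive
  \<open>\<Psi>\<close> the density \<open>- \<Psi>' / \<Psi>\<close> is nonnegative, so its embedding into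
  \<^typ>\<open>ennreal\<close> does not truncate.
\<close>

definition growth_functional ::
  "'a measure \<Rightarrow> (real \<Rightarrow> real) \<Rightarrow> real \<Rightarrow> ereal \<Rightarrow> ('a \<Rightarrow> 'b::real_normed_field) \<Rightarrow> ennreal" where
  "growth_functional M \<Psi> \<epsilon> v f =
     (if v = \<infinity>
      then (SUP t\<in>{0<..<\<epsilon>}. rearrangement M f t / ennreal (\<Psi> t))
      else ennreal_powr
             (\<integral>\<^sup>+ t\<in>{0<..<\<epsilon>}. ennreal_powr (rearrangement M f t / ennreal (\<Psi> t)) (real_of_ereal v)
                               * ennreal (- deriv \<Psi> t / \<Psi> t) \<partial>lborel)
             (1 / real_of_ereal v))"

definition growth_exponents ::
  "'a measure \<Rightarrow> ('a \<Rightarrow> 'b::real_normed_field) set \<Rightarrow> (('a \<Rightarrow> 'b) \<Rightarrow> ennreal) \<Rightarrow>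
   (real \<Rightarrow> real) \<Rightarrow> real \<Rightarrow> ereal set" where
  "growth_exponents M X N \<Psi> \<epsilon> =
     {v. 0 < v \<and> (\<exists>c>0. \<forall>f\<in>X. growth_functional M \<Psi> \<epsilon> v f \<le> ennreal c * N f)}"

text \<open>
  \<open>has_growth_envelope M X N \<Psi> u\<close> states that the growth envelope of \<open>(X, N)\<close> is the pair
  \<open>(\<Psi>, u)\<close>. ``A fixed sufficiently small \<open>\<epsilon>\<close>'' is read as: one \<open>\<epsilon>\<close> for all \<open>v\<close> and \<open>f\<close>,
  and the infimum is \<open>u\<close> for every \<open>\<epsilon>\<close> below some threshold.
\<close>

definition has_growth_envelope ::
  "'a measure \<Rightarrow> ('a \<Rightarrow> 'b::real_normed_field) set \<Rightarrow> (('a \<Rightarrow> 'b) \<Rightarrow> ennreal) \<Rightarrow>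
   (real \<Rightarrow> real) \<Rightarrow> ereal \<Rightarrow> bool" where
  "has_growth_envelope M X N \<Psi> u \<longleftrightarrow>
     (\<forall>t>0. 0 < \<Psi> t) \<and> antimono_on {0<..} \<Psi> \<and> \<Psi> C1_differentiable_on {0<..} \<and> 0 < u \<and>
     (\<exists>\<epsilon>>0. \<exists>A>0. \<exists>B>0. \<forall>t. 0 < t \<and> t < \<epsilon> \<longrightarrow>
        ennreal (A * \<Psi> t) \<le> growth_envelope_function M X N t \<and>
        growth_envelope_function M X N t \<le> ennreal (B * \<Psi> t)) \<and>
     (\<exists>\<epsilon>\<^sub>0>0. \<forall>\<epsilon>. 0 < \<epsilon> \<and> \<epsilon> < \<epsilon>\<^sub>0 \<longrightarrow> Inf (growth_exponents M X N \<Psi> \<epsilon>) = u)"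

end

theory Submission
  imports Defs "HOL-Real_Asymp.Real_Asymp"
begin

text \<open>
  Write \<open>P = p_minus\<close>. If \<open>f/l\<close> has modular at most \<open>1\<close>, then Chebyshev's inequality on
  \<open>{|f| > l s}\<close>, \<open>s \<ge> 1\<close>, gives \<open>f*(t) \<le> l t powr (-1/P)\<close> for \<open>t \<le> 1\<close>, and
  \<open>y powr P \<le> 1 + y powr p x\<close> together with \<open>\<mu>(\<Omega>) < \<infinity>\<close> bounds the \<open>L\<^sub>P\<close> norm of \<open>f\<close>, hence of
  \<open>f*\<close>, by a multiple of \<open>l\<close>. Conversely let \<open>V x\<close> be the volume of the ball around \<open>x\<^sub>0\<close> with
  radius \<open>|x - x\<^sub>0|\<close>, and take \<open>max (V x) \<tau> powr (-1/P)\<close> on \<open>{V < v}\<close>. Log-Hoelder continuity makes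
  \<open>V x powr (-(p x - P)/P)\<close> bounded near \<open>x\<^sub>0\<close>, so the modular of this function is comparable to its
  \<open>L\<^sub>P\<close> integral \<open>1 + ln (v/\<tau>)\<close>. The choice \<open>\<tau> = v = 2t\<close> gives the lower bound for the envelope;
  letting \<open>\<tau> \<rightarrow> 0\<close>, the norm grows like \<open>ln (1/\<tau>) powr (1/P)\<close> while the functional with index \<open>q\<close>
  grows like \<open>ln (1/\<tau>) powr (1/q)\<close>, which excludes every \<open>q < P\<close>.
\<close>

subsection \<open>Layer cake\<close>

text \<open>Serves twice: it recovers a function value from its levels in the layer cake formula,
  and it measures the set of \<open>t\<close> at which a rearrangement exceeds a level.\<close>

lemma emeasure_below_ennreal: "emeasure lborel {s. 0 < s \<and> ennreal s < y} = y"
proof (cases y)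
  case (real r)
  then have "{s. 0 < s \<and> ennreal s < y} = {0<..<r}"
    by (auto simp: ennreal_less_iff)
  with real show ?thesis by simp
next
  case top
  then have "{s. 0 < s \<and> ennreal s < y} = {0<..}" by auto
  moreover have "emeasure lborel {0::real<..} = \<infinity>"
  proof (rule ccontr)
    assume "emeasure lborel {0::real<..} \<noteq> \<infinity>"
    then obtain r where r: "emeasure lborel {0::real<..} = ennreal r" "0 \<le> r"
      by (cases "emeasure lborel {0::real<..}") auto
    have "emeasure lborel {0<..<r + 1} \<le> emeasure lborel {0::real<..}"
      by (intro emeasure_mono) auto
    with r show False by simp
  qed
  ultimately show ?thesis using top by simp
qed

text \<open>The value \<open>g x\<close> is the length of
  \<open>{s. 0 < s \<and> ennreal s < g x}\<close>, also when it is infinite. Tonelli's theorem then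
  exchanges the integrations over \<open>s\<close> and \<open>x\<close>.\<close>

lemma layer_cake:
  fixes g :: "'a \<Rightarrow> ennreal"
  assumes "sigma_finite_measure M" and [measurable]: "g \<in> borel_measurable M"
  shows "(\<integral>\<^sup>+x. g x \<partial>M) = (\<integral>\<^sup>+s\<in>{0<..}. emeasure M {x \<in> space M. ennreal s < g x} \<partial>lborel)"
proof -
  interpret sigma_finite_measure M by fact
  interpret pair_sigma_finite M lborel by unfold_locales
  have "(\<integral>\<^sup>+x. g x \<partial>M) =
      (\<integral>\<^sup>+x. (\<integral>\<^sup>+s. indicator {0<..} s * indicator {x \<in> space M. ennreal s < g x} x \<partial>lborel) \<partial>M)"
  proof (rule nn_integral_cong)
    fix x assume "x \<in> space M"
    then have "(\<integral>\<^sup>+s. indicator {0<..} s * indicator {x \<in> space M. ennreal s < g x} x \<partial>lborel) =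
        (\<integral>\<^sup>+s. indicator {s. 0 < s \<and> ennreal s < g x} s \<partial>lborel)"
      by (intro nn_integral_cong) (auto split: split_indicator)
    also have "\<dots> = g x"
      by (subst nn_integral_indicator) (auto simp: emeasure_below_ennreal)
    finally show "g x = (\<integral>\<^sup>+s. indicator {0<..} s *
        indicator {x \<in> space M. ennreal s < g x} x \<partial>lborel)" ..
  qed
  also have "\<dots> = (\<integral>\<^sup>+s. (\<integral>\<^sup>+x. indicator {0<..} s *
      indicator {x \<in> space M. ennreal s < g x} x \<partial>M) \<partial>lborel)"
    by (rule Fubini'[symmetric]) measurable
  also have "\<dots> = (\<integral>\<^sup>+s\<in>{0<..}. emeasure M {x \<in> space M. ennreal s < g x} \<partial>lborel)"
    by (intro nn_integral_cong) (simp add: nn_integral_cmult mult.commute)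
  finally show ?thesis .
qed

text \<open>The two measure spaces may differ, so functions on the domain can be compared with
  functions on the half-line, in either direction, without polar coordinates.\<close>

lemma nn_integral_mono_distribution:
  fixes g :: "'a \<Rightarrow> ennreal" and h :: "'b \<Rightarrow> ennreal"
  assumes "sigma_finite_measure M" "g \<in> borel_measurable M"
    and "sigma_finite_measure N" "h \<in> borel_measurable N"
    and le: "\<And>s. 0 < s \<Longrightarrow>
      emeasure M {x \<in> space M. ennreal s < g x} \<le> emeasure N {x \<in> space N. ennreal s < h x}"
  shows "(\<integral>\<^sup>+x. g x \<partial>M) \<le> (\<integral>\<^sup>+x. h x \<partial>N)"
  unfolding layer_cake[OF assms(1,2)] layer_cake[OF assms(3,4)]
  by (intro nn_integral_mono) (auto split: split_indicator intro: le)

subsection \<open>Decreasing rearrangements\<close>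

lemma ennreal_powr_ennreal: "0 \<le> x \<Longrightarrow> ennreal_powr (ennreal x) a = ennreal (x powr a)"
  by (simp add: ennreal_powr_def)

lemma ennreal_powr_mono: "0 \<le> a \<Longrightarrow> x \<le> y \<Longrightarrow> ennreal_powr x a \<le> ennreal_powr y a"
  by (cases x; cases y) (auto simp: ennreal_powr_def powr_mono2 top_unique)

lemma less_ennreal_powr_iff:
  assumes "0 < a" "0 \<le> s"
  shows "ennreal s < ennreal_powr x a \<longleftrightarrow> ennreal (s powr (1 / a)) < x"
proof (cases x)
  case (real r)
  have "s < r powr a \<longleftrightarrow> s powr (1 / a) < r"
    using powr_less_mono2[of "1 / a" s "r powr a"] powr_less_mono2[of a "s powr (1/a)" r] assms real
    by (auto simp: powr_powr)
  with real assms show ?thesis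
    by (simp add: ennreal_powr_ennreal ennreal_less_iff)
qed (simp add: ennreal_powr_def)

lemma ennreal_powr_divide:
  assumes "0 < b" shows "ennreal_powr (x / ennreal b) a = ennreal_powr x a / ennreal (b powr a)"
  using assms by (cases x)
    (auto simp: ennreal_powr_def divide_ennreal powr_divide ennreal_top_divide)

lemma rearrangement_antimono: "t \<le> t' \<Longrightarrow> rearrangement M f t' \<le> rearrangement M f t"
  unfolding rearrangement_def
  by (rule INF_superset_mono) (auto intro: order_trans ennreal_leI)

lemma rearrangement_le:
  "0 < s \<Longrightarrow> emeasure M {x \<in> space M. s < norm (f x)} \<le> ennreal t \<Longrightarrow> rearrangement M f t \<le> ennreal s"
  unfolding rearrangement_def by (rule INF_lower) auto

lemma less_rearrangementD:
  assumes less: "ennreal s < rearrangement M f t" "0 \<le> s"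
    and [measurable]: "f \<in> borel_measurable M"
  shows "ennreal t < emeasure M {x \<in> space M. s < norm (f x)}"
proof -
  \<comment> \<open>The infimum runs over positive levels only. A level \<open>r > s\<close> is
    admissible there even when \<open>s = 0\<close>.\<close>
  obtain r where r: "s < r" "ennreal r < rearrangement M f t"
  proof -
    obtain y where "ennreal s < y" "y < rearrangement M f t"
      using dense[OF less(1)] by auto
    with \<open>0 \<le> s\<close> show ?thesis
      by (cases y) (auto simp: ennreal_less_iff intro!: that)
  qed
  with \<open>0 \<le> s\<close> have "ennreal t < emeasure M {x \<in> space M. r < norm (f x)}"
    using rearrangement_le[of r M f t] by (force simp: not_le)
  also have "\<dots> \<le> emeasure M {x \<in> space M. s < norm (f x)}"
    using r by (intro emeasure_mono) auto
  finally show ?thesis .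
qed

lemma le_rearrangement:
  assumes "\<And>s. 0 < s \<Longrightarrow> s < a \<Longrightarrow> ennreal t < emeasure M {x \<in> space M. s < norm (f x)}"
  shows "ennreal a \<le> rearrangement M f t"
  unfolding rearrangement_def
  using assms by (intro INF_greatest ennreal_leI) (force simp: not_less[symmetric])

text \<open>The rearrangement is antitone in \<open>t\<close>, so every superlevel set inside the
  interval is again an interval.\<close>

lemma borel_measurable_rearrangement_powr:
  assumes "0 < q"
  shows "(\<lambda>t. ennreal_powr (rearrangement M f t) q * indicator {0<..<\<epsilon>} t) \<in> borel_measurable borel"
proof (rule borel_measurableI_greater)
  fix y
  let ?h = "\<lambda>t. ennreal_powr (rearrangement M f t) q"
  have "is_interval {t. 0 < t \<and> t < \<epsilon> \<and> y < ?h t}"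
  proof (rule is_interval_1[THEN iffD2], safe)
    fix a b c :: real
    assume "a \<le> c" "c \<le> b" "y < ?h b"
    then show "y < ?h c"
      using \<open>0 < q\<close> by (meson ennreal_powr_mono rearrangement_antimono less_le_trans less_imp_le)
  qed auto
  moreover have "{t \<in> space borel. y < ?h t * indicator {0<..<\<epsilon>} t} = {t. 0 < t \<and> t < \<epsilon> \<and> y < ?h t}"
    by (auto split: split_indicator)
  ultimately show "{t \<in> space borel. y < ?h t * indicator {0<..<\<epsilon>} t} \<in> sets borel"
    by (simp add: real_interval_borel_measurable)
qed

text \<open>If the rearrangement exceeds a level at \<open>t\<close>, then \<open>t\<close> is
  smaller than the measure of the set where \<open>norm (f x)\<close> exceeds that level. Hence the
  distribution function of the rearrangement is dominated by that of
  \<open>norm (f x)\<close>.\<close>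

lemma set_nn_integral_rearrangement_powr_le:
  fixes f :: "'a \<Rightarrow> 'b::real_normed_field"
  assumes "sigma_finite_measure M" and f[measurable]: "f \<in> borel_measurable M" and "0 < q"
  shows "(\<integral>\<^sup>+t\<in>{0<..<\<epsilon>}. ennreal_powr (rearrangement M f t) q \<partial>lborel)
           \<le> (\<integral>\<^sup>+x. ennreal (norm (f x) powr q) \<partial>M)"
proof (rule nn_integral_mono_distribution)
  let ?h = "\<lambda>t. ennreal_powr (rearrangement M f t) q"
  have sup: "{t \<in> space lborel. y < ?h t * indicator {0<..<\<epsilon>} t}
      = {t. 0 < t \<and> t < \<epsilon> \<and> y < ?h t}" for y
    by (auto split: split_indicator)
  show "(\<lambda>t. ?h t * indicator {0<..<\<epsilon>} t) \<in> borel_measurable lborel"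
    using borel_measurable_rearrangement_powr[OF \<open>0 < q\<close>] by simp
  fix s :: real assume "0 < s"
  have eq: "{x \<in> space M. ennreal s < ennreal (norm (f x) powr q)} =
      {x \<in> space M. s powr (1 / q) < norm (f x)}"
    using \<open>0 < q\<close> \<open>0 < s\<close> less_ennreal_powr_iff[of q s "ennreal (norm (f _))"]
    by (simp add: ennreal_powr_ennreal ennreal_less_iff)
  have "emeasure lborel {t. 0 < t \<and> t < \<epsilon> \<and> ennreal s < ?h t}
      \<le> emeasure lborel {t. 0 < t \<and> ennreal t <
        emeasure M {x \<in> space M. s powr (1 / q) < norm (f x)}}"
    using \<open>0 < q\<close> \<open>0 < s\<close>
    by (intro emeasure_mono) (auto simp: less_ennreal_powr_iff intro!: less_rearrangementD)
  then show "emeasure lborel {t \<in> space lborel. ennreal s < ?h t * indicator {0<..<\<epsilon>} t}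
      \<le> emeasure M {x \<in> space M. ennreal s < ennreal (norm (f x) powr q)}"
    unfolding sup eq emeasure_below_ennreal .
qed (use assms sigma_finite_lborel in auto)

subsection \<open>Modulars and norms\<close>

text \<open>Each \<open>P - 1 / Suc n\<close> lies strictly below the supremum defining the
  essential infimum, so it is a lower bound off a null set. Countably many null sets are then
  discarded at once.\<close>

lemma AE_p_minus_le:
  assumes "p_minus \<Omega> p = ereal P"
  shows "AE x in lebesgue_on \<Omega>. P \<le> p x"
proof -
  have "AE x in lebesgue_on \<Omega>. P - 1 / Suc n \<le> p x" for n
  proof -
    have "ereal (P - 1 / Suc n) < Sup {z. AE x in lebesgue_on \<Omega>. z \<le> ereal (p x)}"
      using assms by (simp add: p_minus_def essinf_def)
    then obtain z where "ereal (P - 1 / Suc n) < z" "AE x in lebesgue_on \<Omega>. z \<le> ereal (p x)"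
      unfolding less_Sup_iff by auto
    then show ?thesis
      by (auto elim!: eventually_mono dest: less_le_trans)
  qed
  then have "AE x in lebesgue_on \<Omega>. \<forall>n. P - 1 / Suc n \<le> p x"
    by (simp add: AE_all_countable)
  then show ?thesis
  proof (rule eventually_mono)
    fix x assume le: "\<forall>n. P - 1 / Suc n \<le> p x"
    have "(\<lambda>n. P - 1 / Suc n) \<longlonglongrightarrow> P - 0"
      by (intro tendsto_intros LIMSEQ_Suc lim_1_over_n)
    with le show "P \<le> p x"
      by (auto intro: LIMSEQ_le_const2)
  qed
qed

lemma norm_scaleR_inverse: "0 < l \<Longrightarrow> norm (x /\<^sub>R l) = norm x / l"
  by (simp add: divide_inverse_commute)

lemma modular_antimono_scale:
  fixes f :: "'a::euclidean_space \<Rightarrow> 'b::real_normed_field"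
  assumes "AE x in lebesgue_on \<Omega>. 0 \<le> p x" "0 < l" "l \<le> l'"
  shows "modular \<Omega> p (\<lambda>x. f x /\<^sub>R l') \<le> modular \<Omega> p (\<lambda>x. f x /\<^sub>R l)"
  unfolding modular_def
  using assms by (intro nn_integral_mono_AE) (auto elim!: eventually_mono
      intro!: ennreal_leI powr_mono2 mult_right_mono le_imp_inverse_le)

lemma Lvar_norm_le:
  "0 < l \<Longrightarrow> modular \<Omega> p (\<lambda>x. f x /\<^sub>R l) \<le> 1 \<Longrightarrow> Lvar_norm \<Omega> p f \<le> ennreal l"
  unfolding Lvar_norm_def by (rule INF_lower) auto

text \<open>The strict inequality produces an admissible scale below \<open>l\<close>, so it need
  not be known whether the infimum in the norm is attained.\<close>

lemma modular_le_1_of_Lvar_norm_less: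
  fixes f :: "'a::euclidean_space \<Rightarrow> 'b::real_normed_field"
  assumes "AE x in lebesgue_on \<Omega>. 0 \<le> p x" "Lvar_norm \<Omega> p f < ennreal l"
  shows "modular \<Omega> p (\<lambda>x. f x /\<^sub>R l) \<le> 1"
proof -
  obtain k where "0 < k" "modular \<Omega> p (\<lambda>x. f x /\<^sub>R k) \<le> 1" "ennreal k < ennreal l"
    using assms(2) unfolding Lvar_norm_def INF_less_iff by auto
  moreover from this have "k \<le> l"
    by (simp add: ennreal_less_iff)
  ultimately show ?thesis
    using modular_antimono_scale[OF assms(1)] order_trans by blast
qed

lemma rearrangement_le_of_modular:
  fixes f :: "'a::euclidean_space \<Rightarrow> 'b::real_normed_field"
  assumes [measurable]: "f \<in> borel_measurable (lebesgue_on \<Omega>)"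
    and P: "AE x in lebesgue_on \<Omega>. P \<le> p x" "0 < P"
    and l: "0 < l" "modular \<Omega> p (\<lambda>x. f x /\<^sub>R l) \<le> 1"
    and t: "0 < t" "t \<le> 1"
  shows "rearrangement (lebesgue_on \<Omega>) f t \<le> ennreal (l * t powr (- 1 / P))"
proof (rule rearrangement_le)
  let ?s = "t powr (- 1 / P)"
    and ?A = "{x \<in> space (lebesgue_on \<Omega>). l * t powr (- 1 / P) < norm (f x)}"
  \<comment> \<open>Since \<open>t \<le> 1\<close>, the level \<open>?s\<close> is at least
    \<open>1\<close>, so raising the exponent from \<open>P\<close> to \<open>p x\<close> can only
    enlarge \<open>?s powr P = 1 / t\<close>.\<close>
  have s: "1 \<le> ?s" "?s powr P = 1 / t"
    using t P ge_one_powr_ge_zero[of "1 / t" "1 / P"]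
    by (auto simp: powr_minus_divide powr_powr powr_divide)
  show "0 < l * ?s" using l t by simp
  have "ennreal (1 / t) * emeasure (lebesgue_on \<Omega>) ?A =
      (\<integral>\<^sup>+x. ennreal (1 / t) * indicator ?A x \<partial>lebesgue_on \<Omega>)"
    by (rule nn_integral_cmult_indicator[symmetric]) measurable
  also have "\<dots> \<le> modular \<Omega> p (\<lambda>x. f x /\<^sub>R l)"
    unfolding modular_def
  proof (rule nn_integral_mono_AE, use P(1) in \<open>rule eventually_mono\<close>)
    fix x assume px: "P \<le> p x"
    show "ennreal (1 / t) * indicator ?A x \<le> ennreal (norm (f x /\<^sub>R l) powr p x)"
    proof (cases "x \<in> ?A")
      case True
      then have less: "?s < norm (f x /\<^sub>R l)"
        using l by (simp add: norm_scaleR_inverse field_simps)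
      have "1 / t = ?s powr P" using s by simp
      also have "\<dots> \<le> ?s powr p x"
        using s px by (intro powr_mono) auto
      also have "\<dots> \<le> norm (f x /\<^sub>R l) powr p x"
        using px P less s by (intro powr_mono2) auto
      finally show ?thesis using True by (simp add: ennreal_leI)
    qed simp
  qed
  finally have le: "ennreal (1 / t) * emeasure (lebesgue_on \<Omega>) ?A \<le> 1"
    using l(2) by simp
  have "emeasure (lebesgue_on \<Omega>) ?A = ennreal t * (ennreal (1 / t) * emeasure (lebesgue_on \<Omega>) ?A)"
    using t by (simp add: mult.assoc[symmetric] ennreal_mult[symmetric])
  also have "\<dots> \<le> ennreal t * 1"
    using le by (rule mult_left_mono) simp
  finally show "emeasure (lebesgue_on \<Omega>) ?A \<le> ennreal t" by simp
qed

lemma nn_integral_powr_le_of_modular: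
  fixes f :: "'a::euclidean_space \<Rightarrow> 'b::real_normed_field"
  assumes [measurable]: "f \<in> borel_measurable (lebesgue_on \<Omega>)"
    and [measurable]: "p \<in> borel_measurable (lebesgue_on \<Omega>)"
    and P: "AE x in lebesgue_on \<Omega>. P \<le> p x" "0 < P"
    and l: "0 < l" "modular \<Omega> p (\<lambda>x. f x /\<^sub>R l) \<le> 1"
  shows "(\<integral>\<^sup>+x. ennreal (norm (f x) powr P) \<partial>lebesgue_on \<Omega>)
           \<le> ennreal (l powr P) * (emeasure (lebesgue_on \<Omega>) \<Omega> + 1)"
proof -
  define g where "g x = norm (f x) / l" for x
  have [measurable]: "g \<in> borel_measurable (lebesgue_on \<Omega>)"
    unfolding g_def by measurable
  have "(\<integral>\<^sup>+x. ennreal (norm (f x) powr P) \<partial>lebesgue_on \<Omega>) =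
      (\<integral>\<^sup>+x. ennreal (l powr P) * ennreal (g x powr P) \<partial>lebesgue_on \<Omega>)"
    using l by (intro nn_integral_cong) (simp add: g_def powr_divide ennreal_mult[symmetric])
  also have "\<dots> = ennreal (l powr P) * (\<integral>\<^sup>+x. ennreal (g x powr P) \<partial>lebesgue_on \<Omega>)"
    by (rule nn_integral_cmult) measurable
  also have "(\<integral>\<^sup>+x. ennreal (g x powr P) \<partial>lebesgue_on \<Omega>)
      \<le> (\<integral>\<^sup>+x. 1 + ennreal (norm (f x /\<^sub>R l) powr p x) \<partial>lebesgue_on \<Omega>)"
  proof (rule nn_integral_mono_AE, use P(1) in \<open>rule eventually_mono\<close>)
    fix x assume px: "P \<le> p x"
    have "0 \<le> g x" using l by (simp add: g_def)
    \<comment> \<open>Where \<open>g x \<le> 1\<close> the summand \<open>1\<close> suffices,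
      elsewhere the larger exponent wins. Integrating the \<open>1\<close> produces the measure of
      the domain in the constant.\<close>
    have "g x powr P \<le> 1 + g x powr p x"
    proof (cases "g x \<le> 1")
      case True
      then have "g x powr P \<le> 1"
        using P \<open>0 \<le> g x\<close> powr_mono2[of P "g x" 1] by simp
      then show ?thesis by (simp add: add_increasing2)
    next
      case False
      then show ?thesis using powr_mono[OF px, of "g x"] by linarith
    qed
    then show "ennreal (g x powr P) \<le> 1 + ennreal (norm (f x /\<^sub>R l) powr p x)"
      using l by (simp only: norm_scaleR_inverse g_def) (simp flip: ennreal_1 ennreal_plus)
  qed
  also have "\<dots> = (\<integral>\<^sup>+x. 1 + ennreal (g x powr p x) \<partial>lebesgue_on \<Omega>)"
    using l by (simp only: norm_scaleR_inverse g_def)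
  also have "\<dots> = emeasure (lebesgue_on \<Omega>) \<Omega> + (\<integral>\<^sup>+x. ennreal (g x powr p x) \<partial>lebesgue_on \<Omega>)"
    by (subst nn_integral_add) (auto simp: space_restrict_space)
  also have "(\<integral>\<^sup>+x. ennreal (g x powr p x) \<partial>lebesgue_on \<Omega>) = modular \<Omega> p (\<lambda>x. f x /\<^sub>R l)"
    using l by (simp only: norm_scaleR_inverse g_def modular_def)
  also note add_left_mono[OF l(2)]
  finally show ?thesis by (simp add: mult_left_mono)
qed

subsection \<open>Radial test functions\<close>

text \<open>The volume of the ball around the centre with \<open>x\<close> on its boundary. In this
  radial coordinate the sublevel set at \<open>s\<close> has measure exactly \<open>s\<close>, so
  radial functions have explicit distribution functions.\<close>

definition ball_vol :: "'a::euclidean_space \<Rightarrow> 'a \<Rightarrow> real" where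
  "ball_vol x\<^sub>0 x = unit_ball_vol DIM('a) * norm (x - x\<^sub>0) ^ DIM('a)"

lemma ball_vol_nonneg: "0 \<le> ball_vol x\<^sub>0 x"
  by (simp add: ball_vol_def)

lemma unit_ball_vol_DIM_nonzero [simp]: "unit_ball_vol (real DIM('a::euclidean_space)) \<noteq> 0"
  by (rule less_imp_neq[symmetric]) simp

lemma ball_vol_pos_iff: "0 < ball_vol x\<^sub>0 x \<longleftrightarrow> x \<noteq> x\<^sub>0"
  by (auto simp: ball_vol_def zero_power)

lemma borel_measurable_ball_vol [measurable]: "ball_vol x\<^sub>0 \<in> borel_measurable borel"
  unfolding ball_vol_def by measurable

lemma ball_vol_less_iff:
  fixes x\<^sub>0 :: "'a::euclidean_space"
  assumes "0 \<le> r"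
  shows "ball_vol x\<^sub>0 x < unit_ball_vol DIM('a) * r ^ DIM('a) \<longleftrightarrow> x \<in> ball x\<^sub>0 r"
  using assms power_less_imp_less_base[of "norm (x - x\<^sub>0)" "DIM('a)" r]
    power_strict_mono[of "norm (x - x\<^sub>0)" r "DIM('a)"]
  by (auto simp: ball_vol_def dist_norm norm_minus_commute)

lemma emeasure_ball_vol_less:
  fixes x\<^sub>0 :: "'a::euclidean_space"
  assumes "0 \<le> s"
  shows "emeasure lebesgue {x. ball_vol x\<^sub>0 x < s} = ennreal s"
proof -
  define r where "r = root DIM('a) (s / unit_ball_vol DIM('a))"
  have s: "s = unit_ball_vol DIM('a) * r ^ DIM('a)" "0 \<le> r"
    using assms unit_ball_vol_pos[of "DIM('a)"] by (auto simp: r_def)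
  then have "{x. ball_vol x\<^sub>0 x < s} = ball x\<^sub>0 r"
    by (auto simp: ball_vol_less_iff)
  with s show ?thesis
    by (simp add: emeasure_ball)
qed

text \<open>A truncation of \<open>ball_vol\<close> to the power \<open>- 1 / P\<close>, whose
  \<open>P\<close>-th power just fails to be integrable at the centre. The parameter
  \<open>\<tau>\<close> caps the peak and \<open>v\<close> is the volume of the support; for
  \<open>\<tau> = v\<close> the function is constant on a ball.\<close>

definition test_fun :: "real \<Rightarrow> 'a::euclidean_space \<Rightarrow> real \<Rightarrow> real \<Rightarrow> 'a \<Rightarrow> real" where
  "test_fun P x\<^sub>0 \<tau> v x = (if ball_vol x\<^sub>0 x < v then max (ball_vol x\<^sub>0 x) \<tau> powr (- 1 / P) else 0)"

lemma test_fun_nonneg: "0 \<le> test_fun P x\<^sub>0 \<tau> v x"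
  by (simp add: test_fun_def)

lemma borel_measurable_test_fun [measurable]: "test_fun P x\<^sub>0 \<tau> v \<in> borel_measurable borel"
  unfolding test_fun_def by measurable

lemma sublevel_in_sets_lebesgue: "{x. ball_vol x\<^sub>0 x < s} \<in> sets lebesgue"
  by (rule sets_completionI_sets) measurable

lemma test_fun_rearrangement_ge:
  assumes \<Omega>: "\<Omega> \<in> sets lebesgue" "{x. ball_vol x\<^sub>0 x < v} \<subseteq> \<Omega>"
    and "0 < P" "0 < \<tau>" "0 \<le> t" "t < v"
  shows "ennreal (max t \<tau> powr (- 1 / P)) \<le>
    rearrangement (lebesgue_on \<Omega>) (\<lambda>x. of_real (test_fun P x\<^sub>0 \<tau> v x) :: 'b::real_normed_field) t"
proof (rule le_rearrangement)
  fix s :: real assume s: "0 < s" "s < max t \<tau> powr (- 1 / P)"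
  \<comment> \<open>The measure of the superlevel set at \<open>s\<close>, which is a ball: its
    volume is limited by the support \<open>v\<close> and by the level
    \<open>s powr (- P)\<close>.\<close>
  define m where "m = min v (s powr (- P))"
  have less: "y < s powr (- P) \<longleftrightarrow> s < y powr (- 1 / P)" if "0 < y" for y
    using powr_less_mono2_neg[of "-P" s "y powr (- 1 / P)"] that s \<open>0 < P\<close>
      powr_less_mono2_neg[of "- 1 / P" y "s powr (- P)"]
    by (auto simp: powr_powr)
  have "max t \<tau> < s powr (- P)"
    using s assms by (subst less) auto
  then have \<tau>: "\<tau> < s powr (- P)" and "t < m"
    using assms by (auto simp: m_def)
  \<comment> \<open>The cap drops out of the level condition because \<open>\<tau>\<close> itself
    lies below \<open>s powr (- P)\<close>.\<close>
  have level: "s < max y \<tau> powr - (1 / P) \<longleftrightarrow> y < s powr (- P)" for y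
    using less[of "max y \<tau>"] \<tau> \<open>0 < \<tau>\<close> by simp
  have "{x \<in> space (lebesgue_on \<Omega>). s < norm (of_real (test_fun P x\<^sub>0 \<tau> v x) :: 'b)} =
      {x. ball_vol x\<^sub>0 x < m}"
    using \<Omega> s by (auto simp: m_def test_fun_def space_restrict_space level split: if_splits)
  moreover have "{x. ball_vol x\<^sub>0 x < m} \<subseteq> \<Omega>" "0 \<le> m"
    using \<Omega> \<open>t < m\<close> \<open>0 \<le> t\<close> by (auto simp: m_def)
  ultimately have "emeasure (lebesgue_on \<Omega>)
      {x \<in> space (lebesgue_on \<Omega>). s < norm (of_real (test_fun P x\<^sub>0 \<tau> v x) :: 'b)} = ennreal m"
    using \<Omega> emeasure_ball_vol_less[of m x\<^sub>0] by (simp add: emeasure_restrict_space)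
  with \<open>t < m\<close> \<open>0 \<le> t\<close> show "ennreal t < emeasure (lebesgue_on \<Omega>)
      {x \<in> space (lebesgue_on \<Omega>). s < norm (of_real (test_fun P x\<^sub>0 \<tau> v x) :: 'b)}"
    by (simp add: ennreal_less_iff)
qed

lemma nn_integral_inverse_Icc:
  assumes "0 < a" "a \<le> b"
  shows "(\<integral>\<^sup>+t\<in>{a..b}. ennreal (1 / t) \<partial>lborel) = ennreal (ln (b / a))"
proof -
  have "(\<integral>\<^sup>+t\<in>{a..b}. ennreal (1 / t) \<partial>lborel) = ennreal (ln b - ln a)"
    using assms by (intro nn_integral_FTC_Icc) (auto intro!: derivative_eq_intros)
  with assms show ?thesis by (simp add: ln_div)
qed

text \<open>The \<open>P\<close>-th power of the test function is \<open>h\<close> composed with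
  \<open>ball_vol\<close> away from the centre. Comparing distribution functions turns its integral
  into a one-dimensional integral of \<open>h\<close>.\<close>

lemma nn_integral_test_fun_powr_le:
  fixes x\<^sub>0 :: "'a::euclidean_space"
  assumes \<Omega>: "\<Omega> \<in> sets lebesgue" and fin: "emeasure lebesgue \<Omega> < \<infinity>"
    and "0 < P" "0 < \<tau>" "\<tau> \<le> v"
  shows "(\<integral>\<^sup>+x. ennreal (test_fun P x\<^sub>0 \<tau> v x powr P) \<partial>lebesgue_on \<Omega>) \<le> ennreal (1 + ln (v / \<tau>))"
proof -
  define h where "h u = (if 0 < u \<and> u < v then 1 / max u \<tau> else 0)" for u
  have h[measurable]: "h \<in> borel_measurable borel"
    unfolding h_def by measurable
  have test: "test_fun P x\<^sub>0 \<tau> v x powr P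
      = (if ball_vol x\<^sub>0 x < v then 1 / max (ball_vol x\<^sub>0 x) \<tau> else 0)" for x
    using assms ball_vol_nonneg[of x\<^sub>0 x]
    by (simp add: test_fun_def powr_powr powr_minus_divide[of _ 1])
  have "(\<integral>\<^sup>+x. ennreal (test_fun P x\<^sub>0 \<tau> v x powr P) \<partial>lebesgue_on \<Omega>)
      \<le> (\<integral>\<^sup>+u. ennreal (h u) \<partial>lborel)"
  proof (rule nn_integral_mono_distribution)
    show "sigma_finite_measure (lebesgue_on \<Omega>)"
      using \<Omega> fin finite_measure_lebesgue_on[of \<Omega>]
      by (auto simp: fmeasurable_def finite_measure_def)
    fix s :: real assume "0 < s"
    \<comment> \<open>The superlevel set at \<open>s\<close> lies in the ball of volume
      \<open>m\<close>. It is empty once \<open>s\<close> reaches the peak value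
      \<open>1 / \<tau>\<close>.\<close>
    define m where "m = (if s < 1 / \<tau> then min v (1 / s) else 0)"
    have "0 \<le> m" using assms \<open>0 < s\<close> by (simp add: m_def)
    have "emeasure (lebesgue_on \<Omega>)
        {x \<in> space (lebesgue_on \<Omega>). ennreal s < ennreal (test_fun P x\<^sub>0 \<tau> v x powr P)}
        = emeasure lebesgue {x \<in> \<Omega>. s < test_fun P x\<^sub>0 \<tau> v x powr P}"
      using \<Omega> \<open>0 < s\<close>
      by (subst emeasure_restrict_space) (auto simp: ennreal_less_iff space_restrict_space)
    also have "\<dots> \<le> emeasure lebesgue {x. ball_vol x\<^sub>0 x < m}"
    proof (rule emeasure_mono[OF _ sublevel_in_sets_lebesgue])
      have "ball_vol x\<^sub>0 x < m" if less: "s < test_fun P x\<^sub>0 \<tau> v x powr P" for x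
      proof -
        let ?V = "ball_vol x\<^sub>0 x"
        have V: "?V < v" "s < 1 / max ?V \<tau>"
          using less \<open>0 < s\<close> by (auto simp: test split: if_splits)
        then have "s * max ?V \<tau> < 1"
          using \<open>0 < \<tau>\<close> by (simp add: less_divide_eq)
        moreover have "s * ?V \<le> s * max ?V \<tau>" "s * \<tau> \<le> s * max ?V \<tau>"
          using \<open>0 < s\<close> by (auto intro!: mult_left_mono)
        ultimately have "s * ?V < 1" "s * \<tau> < 1" by linarith+
        with V show ?thesis
          using \<open>0 < s\<close> \<open>0 < \<tau>\<close> by (simp add: m_def field_simps)
      qed
      then show "{x \<in> \<Omega>. s < test_fun P x\<^sub>0 \<tau> v x powr P} \<subseteq> {x. ball_vol x\<^sub>0 x < m}" by auto
    qed
    also have "\<dots> = emeasure lborel {0<..<m}"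
      using \<open>0 \<le> m\<close> emeasure_ball_vol_less[of m x\<^sub>0] by simp
    also have "\<dots> \<le> emeasure lborel {u \<in> space lborel. ennreal s < ennreal (h u)}"
      using \<open>0 < s\<close> assms by (intro emeasure_mono)
        (auto simp: h_def m_def ennreal_less_iff field_simps max_def split: if_splits)
    finally show "emeasure (lebesgue_on \<Omega>)
        {x \<in> space (lebesgue_on \<Omega>). ennreal s < ennreal (test_fun P x\<^sub>0 \<tau> v x powr P)}
        \<le> emeasure lborel {u \<in> space lborel. ennreal s < ennreal (h u)}" .
  next
    show "(\<lambda>x. ennreal (test_fun P x\<^sub>0 \<tau> v x powr P)) \<in> borel_measurable (lebesgue_on \<Omega>)"
      by (intro measurable_restrict_space1 measurable_completion) measurable
  qed (auto intro: sigma_finite_lborel)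
  \<comment> \<open>The capped part on \<open>{0..\<tau>}\<close> contributes \<open>1\<close>, the
    rest contributes the logarithm. The shared endpoint is harmless for an upper bound.\<close>
  also have "\<dots> \<le> (\<integral>\<^sup>+u. ennreal (1 / \<tau>) * indicator {0..\<tau>} u +
      ennreal (1 / u) * indicator {\<tau>..v} u \<partial>lborel)"
    using assms by (intro nn_integral_mono)
      (auto simp: h_def max_def split: split_indicator)
  also have "\<dots> = ennreal (1 / \<tau>) * ennreal \<tau> + ennreal (ln (v / \<tau>))"
    using assms by (subst nn_integral_add)
      (auto simp: nn_integral_cmult_indicator nn_integral_inverse_Icc)
  also have "\<dots> = ennreal (1 + ln (v / \<tau>))"
  proof -
    have "0 \<le> ln (v / \<tau>)" using assms by simp
    then show ?thesis using assms by (simp flip: ennreal_mult)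
  qed
  finally show ?thesis .
qed

text \<open>For a value \<open>a > 0\<close> of the test function, \<open>a powr p x\<close> is
  \<open>a powr (p x - P)\<close> times \<open>a powr P\<close>, where \<open>P\<close> is the
  exponent at the centre. Off the centre \<open>ln a\<close> is at most
  \<open>- ln (ball_vol) / P\<close>, which grows like the logarithm of the distance, exactly what
  log-Hoelder continuity compensates. The constant \<open>K\<close> depends on neither
  \<open>\<tau>\<close> nor \<open>v\<close>.\<close>

lemma LH0_test_bound:
  fixes x\<^sub>0 :: "'a::euclidean_space"
  assumes "open \<Omega>" "x\<^sub>0 \<in> \<Omega>" and LH: "p \<in> LH0 \<Omega> x\<^sub>0"
    and P: "0 < p x\<^sub>0" "AE x in lebesgue_on \<Omega>. p x\<^sub>0 \<le> p x"
  obtains K v\<^sub>0 where "1 \<le> K" "0 < v\<^sub>0" "v\<^sub>0 < 1" "{x. ball_vol x\<^sub>0 x < v\<^sub>0} \<subseteq> \<Omega>"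
    "\<And>\<tau> v. 0 < \<tau> \<Longrightarrow> v \<le> v\<^sub>0 \<Longrightarrow> AE x in lebesgue_on \<Omega>.
      test_fun (p x\<^sub>0) x\<^sub>0 \<tau> v x powr p x \<le> K * test_fun (p x\<^sub>0) x\<^sub>0 \<tau> v x powr p x\<^sub>0"
proof -
  let ?P = "p x\<^sub>0" and ?d = "DIM('a)" and ?\<omega> = "unit_ball_vol DIM('a)"
  obtain C where C: "0 < C"
    "\<And>x. x \<in> \<Omega> \<Longrightarrow> norm (x - x\<^sub>0) < 1 / 2 \<Longrightarrow> \<bar>p x - ?P\<bar> \<le> C / (- ln (norm (x - x\<^sub>0)))"
    using LH unfolding LH0_def by auto
  obtain e where e: "0 < e" "ball x\<^sub>0 e \<subseteq> \<Omega>"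
    using \<open>open \<Omega>\<close> \<open>x\<^sub>0 \<in> \<Omega>\<close> open_contains_ball by blast
  \<comment> \<open>The bound \<open>1 / 2\<close> makes the log-Hoelder estimate available, the
    bound \<open>e\<close> keeps the ball inside the domain.\<close>
  define r where "r = min e (1 / 2)"
  \<comment> \<open>The cap \<open>1 / 2\<close> ensures a volume below \<open>1\<close>, which
    later keeps \<open>t\<close> in the range of the upper envelope bound.\<close>
  define v\<^sub>0 where "v\<^sub>0 = min (1 / 2) (?\<omega> * r ^ ?d)"
  \<comment> \<open>In \<open>- ln (ball_vol)\<close> the dimension multiplies \<open>- ln\<close>
    of the distance, which cancels against the log-Hoelder bound. The remaining
    \<open>\<bar>ln ?\<omega>\<bar>\<close> is divided by \<open>- ln\<close> of the distance, which
    exceeds \<open>ln 2\<close>.\<close>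
  define L where "L = C / ?P * (\<bar>ln ?\<omega>\<bar> / ln 2 + ?d)"
  have "0 < r" using e by (simp add: r_def)
  then have v0: "0 < v\<^sub>0" "v\<^sub>0 < 1" by (auto simp: v\<^sub>0_def)
  have ball: "x \<in> ball x\<^sub>0 r" if "ball_vol x\<^sub>0 x < v\<^sub>0" for x
    using that \<open>0 < r\<close> ball_vol_less_iff[of r x\<^sub>0 x] by (simp add: v\<^sub>0_def)
  then have sub: "{x. ball_vol x\<^sub>0 x < v\<^sub>0} \<subseteq> \<Omega>"
    using e by (fastforce simp: r_def)
  have "0 \<le> L" using C P by (simp add: L_def)
  have exponent: "(p x - ?P) / ?P * (- ln (ball_vol x\<^sub>0 x)) \<le> L"
    if "?P \<le> p x" "x \<noteq> x\<^sub>0" "ball_vol x\<^sub>0 x < v\<^sub>0" for x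
  proof -
    let ?n = "norm (x - x\<^sub>0)"
    have n: "0 < ?n" "?n < 1 / 2"
      using that ball[of x] by (auto simp: r_def dist_norm norm_minus_commute)
    then have "ln ?n < ln (1 / 2)" by (subst ln_less_cancel_iff) auto
    then have ln: "ln 2 < - ln ?n" by (simp add: ln_div)
    have "0 < ln (2::real)" by simp
    have px: "p x - ?P \<le> C / (- ln ?n)"
      using C(2)[of x] sub that n by auto
    have "- ln (ball_vol x\<^sub>0 x) = - ln ?\<omega> + ?d * (- ln ?n)"
      using n unit_ball_vol_pos[of ?d] by (simp add: ball_vol_def ln_mult ln_realpow)
    also have "\<dots> \<le> \<bar>ln ?\<omega>\<bar> + ?d * (- ln ?n)" by simp
    finally have "(p x - ?P) / ?P * (- ln (ball_vol x\<^sub>0 x))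
        \<le> (p x - ?P) / ?P * (\<bar>ln ?\<omega>\<bar> + ?d * (- ln ?n))"
      using that P by (intro mult_left_mono) auto
    also have "\<dots> \<le> C / (- ln ?n) / ?P * (\<bar>ln ?\<omega>\<bar> + ?d * (- ln ?n))"
    proof (rule mult_right_mono)
      show "0 \<le> \<bar>ln ?\<omega>\<bar> + ?d * (- ln ?n)"
        using ln \<open>0 < ln 2\<close> by (intro add_nonneg_nonneg mult_nonneg_nonneg) linarith+
    qed (use px P in \<open>intro divide_right_mono, auto\<close>)
    also have "\<dots> = C / ?P * (\<bar>ln ?\<omega>\<bar> / (- ln ?n) + ?d)"
    proof -
      have "ln ?n \<noteq> 0" using ln \<open>0 < ln 2\<close> by linarith
      then show ?thesis using P by (simp add: field_simps)
    qed
    also have "\<dots> \<le> L"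
      unfolding L_def using C P ln \<open>0 < ln 2\<close>
      by (intro mult_left_mono add_right_mono divide_left_mono mult_pos_pos) (linarith | simp)+
    finally show ?thesis .
  qed
  show ?thesis
  proof (rule that[of "exp L" v\<^sub>0])
    fix \<tau> v :: real assume v: "0 < \<tau>" "v \<le> v\<^sub>0"
    show "AE x in lebesgue_on \<Omega>. test_fun ?P x\<^sub>0 \<tau> v x powr p x
        \<le> exp L * test_fun ?P x\<^sub>0 \<tau> v x powr ?P"
      using P(2)
    proof (rule eventually_mono)
      fix x assume px: "?P \<le> p x"
      let ?V = "ball_vol x\<^sub>0 x"
      define a where "a = test_fun ?P x\<^sub>0 \<tau> v x"
      \<comment> \<open>At the centre the logarithm of \<open>ball_vol\<close> carries no
        information, but there both exponents agree. Outside the support both sides vanish.\<close>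
      consider "x = x\<^sub>0" | "v \<le> ?V" | "x \<noteq> x\<^sub>0" "?V < v"
        by linarith
      then have "a powr p x \<le> exp L * a powr ?P"
      proof cases
        case 1
        then show ?thesis using \<open>0 \<le> L\<close> mult_right_mono[of 1 "exp L" "a powr ?P"] by simp
      next
        case 2
        then show ?thesis by (simp add: a_def test_fun_def)
      next
        case 3
        then have V: "0 < ?V" by (simp add: ball_vol_pos_iff)
        have a: "0 < a" using 3 V by (simp add: a_def test_fun_def)
        have "ln a = - ln (max ?V \<tau>) / ?P"
          using 3 V by (simp add: a_def test_fun_def)
        also have "\<dots> \<le> - ln ?V / ?P"
          using P V by (intro divide_right_mono) auto
        finally have "(p x - ?P) * ln a \<le> (p x - ?P) * (- ln ?V / ?P)"
          using px by (intro mult_left_mono) auto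
        also have "\<dots> \<le> L"
          using exponent[OF px] 3 v by simp
        finally have "exp ((p x - ?P) * ln a) \<le> exp L" by simp
        moreover have "a powr p x = exp ((p x - ?P) * ln a) * a powr ?P"
          using a by (simp add: powr_def flip: exp_add) (simp add: algebra_simps)
        ultimately show ?thesis by (simp add: mult_right_mono)
      qed
      then show "test_fun ?P x\<^sub>0 \<tau> v x powr p x \<le> exp L * test_fun ?P x\<^sub>0 \<tau> v x powr ?P"
        by (simp add: a_def)
    qed
  qed (use \<open>0 \<le> L\<close> v0 sub in auto)
qed

text \<open>The bound by \<open>K\<close> replaces the variable exponent by \<open>P\<close>, at the
  cost of a factor, so the \<open>P\<close>-integral of the test function decides which scale
  \<open>l\<close> is admissible.\<close>

lemma modular_test_fun_le_1:
  assumes \<Omega>: "\<Omega> \<in> sets lebesgue" "emeasure lebesgue \<Omega> < \<infinity>"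
    and P: "0 < P" "AE x in lebesgue_on \<Omega>. P \<le> p x"
    and K: "0 \<le> K" "AE x in lebesgue_on \<Omega>. test_fun P x\<^sub>0 \<tau> v x powr p x
        \<le> K * test_fun P x\<^sub>0 \<tau> v x powr P"
    and v: "0 < \<tau>" "\<tau> \<le> v" and l: "1 \<le> l" "K * (1 + ln (v / \<tau>)) \<le> l powr P"
  shows "modular \<Omega> p (\<lambda>x. of_real (test_fun P x\<^sub>0 \<tau> v x) /\<^sub>R l :: 'b::real_normed_field) \<le> 1"
proof -
  let ?g = "test_fun P x\<^sub>0 \<tau> v"
  have meas: "(\<lambda>x. ennreal (?g x powr P)) \<in> borel_measurable (lebesgue_on \<Omega>)"
    by (intro measurable_restrict_space1 measurable_completion) measurable
  have "modular \<Omega> p (\<lambda>x. of_real (?g x) /\<^sub>R l :: 'b)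
      \<le> (\<integral>\<^sup>+x. ennreal (K / l powr P) * ennreal (?g x powr P) \<partial>lebesgue_on \<Omega>)"
    unfolding modular_def
  proof (rule nn_integral_mono_AE, use P(2) K(2) in eventually_elim)
    fix x assume px: "P \<le> p x" and le: "?g x powr p x \<le> K * ?g x powr P"
    have "norm (of_real (?g x) /\<^sub>R l :: 'b) powr p x = ?g x powr p x / l powr p x"
      using l test_fun_nonneg[of P x\<^sub>0 \<tau> v x]
      by (simp only: norm_scaleR_inverse norm_of_real) (simp add: powr_divide)
    \<comment> \<open>Since \<open>l \<ge> 1\<close>, the denominator \<open>l powr p x\<close> is
      at least \<open>l powr P\<close>.\<close>
    also have "\<dots> \<le> (K * ?g x powr P) / l powr P"
      using px le l K powr_mono[OF px] by (intro frac_le) auto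
    finally show "ennreal (norm (of_real (?g x) /\<^sub>R l :: 'b) powr p x)
        \<le> ennreal (K / l powr P) * ennreal (?g x powr P)"
      using K by (simp add: ennreal_leI flip: ennreal_mult)
  qed
  also have "\<dots> = ennreal (K / l powr P) * (\<integral>\<^sup>+x. ennreal (?g x powr P) \<partial>lebesgue_on \<Omega>)"
    by (rule nn_integral_cmult[OF meas])
  also have "\<dots> \<le> ennreal (K / l powr P) * ennreal (1 + ln (v / \<tau>))"
    using nn_integral_test_fun_powr_le[OF \<Omega> P(1) v] by (rule mult_left_mono) simp
  also have "\<dots> = ennreal (K * (1 + ln (v / \<tau>)) / l powr P)"
    using K v by (subst ennreal_mult[symmetric]) auto
  also have "\<dots> \<le> 1"
    using l by (simp add: divide_le_eq)
  finally show ?thesis .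
qed

lemma borel_measurable_of_real_test_fun:
  "(\<lambda>x. of_real (test_fun P x\<^sub>0 \<tau> v x) /\<^sub>R l :: 'b::real_normed_field)
    \<in> borel_measurable (lebesgue_on \<Omega>)"
  by (intro measurable_restrict_space1 measurable_completion) measurable

lemma rearrangement_scaleR_ge:
  assumes le: "ennreal a \<le> rearrangement M f t" and "0 < l"
  shows "ennreal (a / l) \<le> rearrangement M (\<lambda>x. f x /\<^sub>R l) t"
  unfolding rearrangement_def
proof (rule INF_greatest)
  fix s assume s: "s \<in> {s. 0 < s \<and> emeasure M {x \<in> space M. s < norm (f x /\<^sub>R l)} \<le> ennreal t}"
  have "{x \<in> space M. l * s < norm (f x)} = {x \<in> space M. s < norm (f x /\<^sub>R l)}"
    using \<open>0 < l\<close>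
    by (auto simp: norm_scaleR_inverse less_divide_eq mult.commute simp del: norm_scaleR)
  with s have "rearrangement M f t \<le> ennreal (l * s)"
    using \<open>0 < l\<close> by (intro rearrangement_le) auto
  with le have "ennreal a \<le> ennreal (l * s)" by (rule order_trans)
  then have "a \<le> l * s"
    using s \<open>0 < l\<close> by simp
  then show "ennreal (a / l) \<le> ennreal s"
    using \<open>0 < l\<close> by (intro ennreal_leI) (simp add: divide_le_eq mult.commute)
qed

subsection \<open>Growth functionals for power weights\<close>

text \<open>The density \<open>- \<Psi>' / \<Psi>\<close> is \<open>1 / (P t)\<close>, and dividing
  by \<open>\<Psi>\<close> to the power \<open>v\<close> contributes \<open>t powr (v / P)\<close>.
  For \<open>v = P\<close> the weight becomes the constant \<open>1 / P\<close>.\<close>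

lemma growth_functional_powr:
  assumes "0 < P" "0 < v"
  shows "growth_functional M (\<lambda>t. t powr (- 1 / P)) \<epsilon> (ereal v) f =
    ennreal_powr (\<integral>\<^sup>+t\<in>{0<..<\<epsilon>}. ennreal_powr (rearrangement M f t) v
      * ennreal (t powr (v / P - 1) / P) \<partial>lborel) (1 / v)"
proof -
  have "ennreal_powr (rearrangement M f t / ennreal (t powr (- 1 / P))) v
      * ennreal (- deriv (\<lambda>t. t powr (- 1 / P)) t / t powr (- 1 / P)) =
      ennreal_powr (rearrangement M f t) v * ennreal (t powr (v / P - 1) / P)" if "0 < t" for t
  proof -
    have "deriv (\<lambda>t. t powr (- 1 / P)) t = (- 1 / P) * t powr (- 1 / P - 1)"
      using that by (intro DERIV_imp_deriv has_real_derivative_powr)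
    then have weight: "- deriv (\<lambda>t. t powr (- 1 / P)) t / t powr (- 1 / P) = 1 / (P * t)"
      using that assms by (simp add: powr_diff)
    have "ennreal (1 / (P * t)) / ennreal (t powr (- v / P)) = ennreal (t powr (v / P - 1) / P)"
      using that assms
      by (subst divide_ennreal) (simp_all add: powr_minus powr_diff, simp add: field_simps)
    moreover have "(t powr (- 1 / P)) powr v = t powr (- v / P)"
      by (simp add: powr_powr)
    ultimately show ?thesis
      unfolding weight using that by (simp only: ennreal_powr_divide powr_gt_zero)
       (metis ennreal_divide_times)
  qed
  then show ?thesis
    using assms unfolding growth_functional_def
    by (auto intro!: arg_cong2[where f = ennreal_powr] nn_integral_cong split: split_indicator)
qed

lemma growth_functional_powr_le:
  fixes f :: "'a::euclidean_space \<Rightarrow> 'b::real_normed_field"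
  assumes \<Omega>: "\<Omega> \<in> sets lebesgue" "emeasure lebesgue \<Omega> < \<infinity>"
    and f: "f \<in> borel_measurable (lebesgue_on \<Omega>)" and p: "p \<in> borel_measurable (lebesgue_on \<Omega>)"
    and P: "AE x in lebesgue_on \<Omega>. P \<le> p x" "0 < P"
  shows "growth_functional (lebesgue_on \<Omega>) (\<lambda>t. t powr (- 1 / P)) \<epsilon> (ereal P) f
    \<le> ennreal (((measure lebesgue \<Omega> + 1) / P) powr (1 / P)) * Lvar_norm \<Omega> p f"
proof -
  let ?M = "lebesgue_on \<Omega>" and ?m = "measure lebesgue \<Omega> + 1"
  let ?c = "(?m / P) powr (1 / P)"
    and ?F = "growth_functional (lebesgue_on \<Omega>) (\<lambda>t. t powr (- 1 / P)) \<epsilon> (ereal P) f"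
  have "finite_measure ?M"
    using \<Omega> by (intro finite_measure_lebesgue_on) (auto simp: fmeasurable_def)
  then interpret sigma_finite_measure ?M by (simp add: finite_measure_def)
  have m: "emeasure ?M \<Omega> + 1 = ennreal ?m" "0 < ?m"
    using \<Omega> by (auto simp: emeasure_restrict_space measure_restrict_space
        emeasure_eq_ennreal_measure add_nonneg_pos simp flip: ennreal_1 ennreal_plus)
  \<comment> \<open>For \<open>v = P\<close> the functional is, up to \<open>1 / P\<close>, the
    \<open>P\<close>-norm of the rearrangement, so the two \<open>P\<close>-integral estimates bound
    it by a multiple of any admissible scale \<open>l\<close>.\<close>
  have le: "?F \<le> ennreal (?c * l)" if l: "0 < l" "modular \<Omega> p (\<lambda>x. f x /\<^sub>R l) \<le> 1" for l
  proof -
    have "(\<integral>\<^sup>+t\<in>{0<..<\<epsilon>}. ennreal_powr (rearrangement ?M f t) P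
          * ennreal (t powr (P / P - 1) / P) \<partial>lborel)
        = (\<integral>\<^sup>+t. (ennreal_powr (rearrangement ?M f t) P * indicator {0<..<\<epsilon>} t)
          * ennreal (1 / P) \<partial>lborel)"
      using P by (intro nn_integral_cong) (auto split: split_indicator)
    also have "\<dots> = (\<integral>\<^sup>+t\<in>{0<..<\<epsilon>}. ennreal_powr (rearrangement ?M f t) P \<partial>lborel) * ennreal (1 / P)"
      by (intro nn_integral_multc) (simp add: borel_measurable_rearrangement_powr[OF P(2)])
    also have "\<dots> \<le> (ennreal (l powr P) * ennreal ?m) * ennreal (1 / P)"
      using set_nn_integral_rearrangement_powr_le[OF sigma_finite_measure_axioms f P(2), of \<epsilon>]
        nn_integral_powr_le_of_modular[OF f p P l] unfolding m
      by (intro mult_right_mono) (auto intro: order_trans)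
    also have "\<dots> = ennreal (l powr P * (?m / P))"
      using P m(2) by (simp del: ennreal_plus flip: ennreal_mult)
    finally have "?F \<le> ennreal_powr (ennreal (l powr P * (?m / P))) (1 / P)"
      unfolding growth_functional_powr[OF P(2) P(2)] using P by (intro ennreal_powr_mono) auto
    also have "\<dots> = ennreal (?c * l)"
      using P m(2) l powr_mult[of "l powr P" "?m / P" "1 / P"]
      by (simp add: ennreal_powr_ennreal powr_powr mult.commute)
    finally show ?thesis .
  qed
  have "0 < ?c" using m P by simp
  \<comment> \<open>With the constant moved to the left, the quotient is a lower bound of all
    admissible scales and hence of their infimum.\<close>
  have "?F / ennreal ?c \<le> Lvar_norm \<Omega> p f"
    unfolding Lvar_norm_def
  proof (rule INF_greatest)
    fix l assume "l \<in> {l. 0 < l \<and> modular \<Omega> p (\<lambda>x. f x /\<^sub>R l) \<le> 1}"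
    with le[of l] \<open>0 < ?c\<close> show "?F / ennreal ?c \<le> ennreal l"
      by (intro divide_le_posI_ennreal) (auto simp: ennreal_mult)
  qed
  then have "ennreal ?c * (?F / ennreal ?c) \<le> ennreal ?c * Lvar_norm \<Omega> p f"
    by (rule mult_left_mono) simp
  moreover have "ennreal ?c * (?F / ennreal ?c) = ?F"
    unfolding ennreal_times_divide
    by (subst mult.commute, rule mult_divide_eq_ennreal) (use \<open>0 < ?c\<close> in auto)
  ultimately show ?thesis by simp
qed

text \<open>On \<open>{\<tau>..\<delta>}\<close> the rearrangement dominates the envelope function
  itself, so the integrand is at least \<open>1 / (P t)\<close> whatever \<open>v\<close> is. The
  index enters only through the outer power \<open>1 / v\<close>.\<close>

lemma growth_functional_test_fun_ge:
  assumes \<Omega>: "\<Omega> \<in> sets lebesgue" "{x. ball_vol x\<^sub>0 x < v\<^sub>0} \<subseteq> \<Omega>"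
    and "0 < P" "0 < v" "0 < \<tau>" "\<tau> \<le> \<delta>" "\<delta> < \<epsilon>" "\<epsilon> \<le> v\<^sub>0"
  shows "ennreal ((ln (\<delta> / \<tau>) / P) powr (1 / v)) \<le>
    growth_functional (lebesgue_on \<Omega>) (\<lambda>t. t powr (- 1 / P)) \<epsilon> (ereal v)
      (\<lambda>x. of_real (test_fun P x\<^sub>0 \<tau> v\<^sub>0 x) :: 'b::real_normed_field)"
proof -
  let ?f = "\<lambda>x. of_real (test_fun P x\<^sub>0 \<tau> v\<^sub>0 x) :: 'b"
  have ln: "0 \<le> ln (\<delta> / \<tau>)" using assms by simp
  have "ennreal (ln (\<delta> / \<tau>) / P) = ennreal (1 / P) * (\<integral>\<^sup>+t\<in>{\<tau>..\<delta>}. ennreal (1 / t) \<partial>lborel)"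
    using assms ln by (simp add: nn_integral_inverse_Icc flip: ennreal_mult)
  also have "\<dots> = (\<integral>\<^sup>+t. ennreal (1 / P) * (ennreal (1 / t) * indicator {\<tau>..\<delta>} t) \<partial>lborel)"
    by (rule nn_integral_cmult[symmetric]) measurable
  also have "\<dots> \<le> (\<integral>\<^sup>+t\<in>{0<..<\<epsilon>}. ennreal_powr (rearrangement (lebesgue_on \<Omega>) ?f t) v
      * ennreal (t powr (v / P - 1) / P) \<partial>lborel)"
  proof (rule nn_integral_mono)
    fix t
    show "ennreal (1 / P) * (ennreal (1 / t) * indicator {\<tau>..\<delta>} t) \<le>
      ennreal_powr (rearrangement (lebesgue_on \<Omega>) ?f t) v
        * ennreal (t powr (v / P - 1) / P) * indicator {0<..<\<epsilon>} t"
    proof (cases "t \<in> {\<tau>..\<delta>}")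
      case True
      then have t: "0 < t" "t < \<epsilon>" "max t \<tau> = t" using assms by auto
      have "ennreal (t powr (- 1 / P)) \<le> rearrangement (lebesgue_on \<Omega>) ?f t"
        using test_fun_rearrangement_ge[OF \<Omega> \<open>0 < P\<close> \<open>0 < \<tau>\<close>, of t] t assms by simp
      then have "ennreal_powr (ennreal (t powr (- 1 / P))) v
          \<le> ennreal_powr (rearrangement (lebesgue_on \<Omega>) ?f t) v"
        using assms by (intro ennreal_powr_mono) auto
      then have "ennreal (t powr (- v / P)) * ennreal (t powr (v / P - 1) / P)
          \<le> ennreal_powr (rearrangement (lebesgue_on \<Omega>) ?f t) v * ennreal (t powr (v / P - 1) / P)"
        by (intro mult_right_mono) (auto simp: ennreal_powr_ennreal powr_powr)
      moreover have "t powr (- v / P) * (t powr (v / P - 1) / P) = 1 / P * (1 / t)"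
        using t by (simp add: powr_minus powr_diff field_simps)
      ultimately show ?thesis
        using True t assms by (simp flip: ennreal_mult)
    qed simp
  qed
  finally have "ennreal_powr (ennreal (ln (\<delta> / \<tau>) / P)) (1 / v)
      \<le> growth_functional (lebesgue_on \<Omega>) (\<lambda>t. t powr (- 1 / P)) \<epsilon> (ereal v) ?f"
    unfolding growth_functional_powr[OF \<open>0 < P\<close> \<open>0 < v\<close>] using assms
    by (intro ennreal_powr_mono) auto
  then show ?thesis
    using ln assms by (simp add: ennreal_powr_ennreal)
qed

lemma powr_growth_contradiction:
  fixes a b c A K P :: real
  assumes "b < a" "0 < b" "0 < P" "0 \<le> A" "0 \<le> K"
    and le: "\<And>n::nat. (n / P) powr a \<le> c * (A + K * n) powr b"
  shows False
proof -
  define D where "D = \<bar>c\<bar> * (A + K) powr b * P powr a"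
  have "real n powr (a - b) \<le> D" if "1 \<le> n" for n :: nat
  proof -
    \<comment> \<open>Absorbing \<open>A\<close> into the linear term reduces the claim to comparing
      two pure powers of \<open>n\<close>.\<close>
    have "A + K * n \<le> (A + K) * n"
      using that \<open>0 \<le> A\<close> mult_left_mono[of 1 "real n" A] by (simp add: algebra_simps)
    then have "(A + K * n) powr b \<le> (A + K) powr b * n powr b"
      using assms by (subst powr_mult[symmetric]) (auto intro!: powr_mono2)
    then have "c * (A + K * n) powr b \<le> \<bar>c\<bar> * ((A + K) powr b * n powr b)"
      by (intro mult_mono) auto
    with le[of n] have "(n / P) powr a \<le> \<bar>c\<bar> * ((A + K) powr b * n powr b)" by linarith
    then show ?thesis
      using that \<open>0 < P\<close> by (simp add: D_def powr_divide powr_diff field_simps)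
  qed
  moreover have "filterlim (\<lambda>n. real n powr (a - b)) at_top sequentially"
    using \<open>b < a\<close> by real_asymp
  then have "eventually (\<lambda>n. D < real n powr (a - b) \<and> 1 \<le> n) sequentially"
    by (intro eventually_conj eventually_ge_at_top) (simp add: filterlim_at_top_dense)
  then obtain n where "D < real n powr (a - b)" "1 \<le> n"
    using eventually_happens by force
  ultimately show False by fastforce
qed

section \<open>Two-sided envelope bound and fine index\<close>

theorem corollary5p20:
  fixes \<Omega> :: "'a::euclidean_space set" and p :: "'a \<Rightarrow> real"
  assumes "open \<Omega>" and "emeasure lebesgue \<Omega> < \<infinity>"
    and "p \<in> exponent_functions \<Omega>"
    and "1 < p_minus \<Omega> p" and "p_minus \<Omega> p \<le> p_plus \<Omega> p" and "p_plus \<Omega> p < \<infinity>"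
    and "\<exists>x\<^sub>0\<in>\<Omega>. ereal (p x\<^sub>0) = p_minus \<Omega> p \<and> p \<in> LH0 \<Omega> x\<^sub>0"
  shows "has_growth_envelope (lebesgue_on \<Omega>)
           (Lvar \<Omega> p :: ('a \<Rightarrow> 'b::real_normed_field) set) (Lvar_norm \<Omega> p)
           (\<lambda>t. t powr (- 1 / real_of_ereal (p_minus \<Omega> p))) (p_minus \<Omega> p)"
proof -
  obtain x\<^sub>0 where x0: "x\<^sub>0 \<in> \<Omega>" "p_minus \<Omega> p = ereal (p x\<^sub>0)" "p \<in> LH0 \<Omega> x\<^sub>0"
    using assms(7) by auto
  define P where "P = p x\<^sub>0"
  have pm: "p_minus \<Omega> p = ereal P" using x0 by (simp add: P_def)
  have "0 < P" using assms(4) by (simp add: pm)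
  have AE_P: "AE x in lebesgue_on \<Omega>. P \<le> p x"
    by (rule AE_p_minus_le[OF pm])
  then have AE_0: "AE x in lebesgue_on \<Omega>. 0 \<le> p x"
    using \<open>0 < P\<close> by (auto elim!: eventually_mono)
  have p: "p \<in> borel_measurable (lebesgue_on \<Omega>)"
    using assms(3) by (simp add: exponent_functions_def)
  have \<Omega>: "\<Omega> \<in> sets lebesgue" "emeasure lebesgue \<Omega> < \<infinity>"
    using assms by auto
  obtain K v\<^sub>0 where K: "1 \<le> K" and v0: "0 < v\<^sub>0" "v\<^sub>0 < 1" and sub: "{x. ball_vol x\<^sub>0 x < v\<^sub>0} \<subseteq> \<Omega>"
    and bound: "\<And>\<tau> v. 0 < \<tau> \<Longrightarrow> v \<le> v\<^sub>0 \<Longrightarrow> AE x in lebesgue_on \<Omega>.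
      test_fun P x\<^sub>0 \<tau> v x powr p x \<le> K * test_fun P x\<^sub>0 \<tau> v x powr P"
    by (rule LH0_test_bound[OF assms(1) x0(1,3), folded P_def, OF \<open>0 < P\<close> AE_P]) blast
  have test: "modular \<Omega> p (\<lambda>x. of_real (test_fun P x\<^sub>0 \<tau> v x) /\<^sub>R l :: 'b) \<le> 1"
    if "0 < \<tau>" "\<tau> \<le> v" "v \<le> v\<^sub>0" "1 \<le> l" "K * (1 + ln (v / \<tau>)) \<le> l powr P" for \<tau> v l
    using modular_test_fun_le_1[OF \<Omega> \<open>0 < P\<close> AE_P _ bound] that K by simp
  let ?M = "lebesgue_on \<Omega>" and ?X = "Lvar \<Omega> p :: ('a \<Rightarrow> 'b) set"
    and ?\<Psi> = "\<lambda>t::real. t powr (- 1 / P)"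
  have X_I: "f \<in> ?X" if "f \<in> borel_measurable ?M" "0 < l" "modular \<Omega> p (\<lambda>x. f x /\<^sub>R l) \<le> 1" for f l
    using that le_less_trans[OF that(3)] by (auto simp: Lvar_def)
  have upper: "growth_envelope_function ?M ?X (Lvar_norm \<Omega> p) t \<le> ennreal (2 * ?\<Psi> t)"
    if "0 < t" "t < 1" for t
    unfolding growth_envelope_function_def
  proof (rule SUP_least)
    fix f :: "'a \<Rightarrow> 'b" assume f: "f \<in> {f \<in> Lvar \<Omega> p. Lvar_norm \<Omega> p f \<le> 1}"
    \<comment> \<open>Any scale above \<open>1\<close> is admissible for a function of norm at most
      \<open>1\<close>; the choice \<open>2\<close> becomes the constant \<open>B\<close>.\<close>
    then have "Lvar_norm \<Omega> p f < ennreal 2"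
      by (auto elim!: le_less_trans)
    then have "modular \<Omega> p (\<lambda>x. f x /\<^sub>R 2) \<le> 1"
      by (rule modular_le_1_of_Lvar_norm_less[OF AE_0])
    with f that \<open>0 < P\<close> AE_P show "rearrangement ?M f t \<le> ennreal (2 * ?\<Psi> t)"
      by (intro rearrangement_le_of_modular) (auto simp: Lvar_def)
  qed
  \<comment> \<open>For \<open>\<tau> = v\<close> the logarithm vanishes and the scale condition
    reads \<open>K \<le> l powr P\<close>, so \<open>k\<close> is the least scale satisfying
    it.\<close>
  define k where "k = K powr (1 / P)"
  have k: "1 \<le> k" "k powr P = K"
    using K \<open>0 < P\<close> by (auto simp: k_def powr_powr ge_one_powr_ge_zero)
  have lower: "ennreal ((2 powr (- 1 / P) / k) * ?\<Psi> t)
      \<le> growth_envelope_function ?M ?X (Lvar_norm \<Omega> p) t"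
    if t: "0 < t" "t < v\<^sub>0 / 2" for t
  proof -
    \<comment> \<open>The support has volume \<open>2 * t\<close> because the rearrangement at
      \<open>t\<close> is controlled only when \<open>t\<close> is strictly below the volume of the
      support.\<close>
    let ?f = "\<lambda>x. of_real (test_fun P x\<^sub>0 (2 * t) (2 * t) x) :: 'b"
    let ?g = "\<lambda>x. ?f x /\<^sub>R k"
    have g: "modular \<Omega> p ?g \<le> 1"
      using t k by (intro test) auto
    have "ennreal (max t (2 * t) powr (- 1 / P)) \<le> rearrangement ?M ?f t"
      using t sub \<Omega> \<open>0 < P\<close> by (intro test_fun_rearrangement_ge) auto
    then have "ennreal (max t (2 * t) powr (- 1 / P) / k) \<le> rearrangement ?M ?g t"
      by (rule rearrangement_scaleR_ge) (use k in simp)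
    moreover have "max t (2 * t) powr (- 1 / P) / k = (2 powr (- 1 / P) / k) * ?\<Psi> t"
      using t by (simp add: max_def powr_mult)
    moreover have "Lvar_norm \<Omega> p ?g \<le> 1" "?g \<in> ?X"
      using g Lvar_norm_le[of 1 \<Omega> p ?g] X_I[of ?g 1, OF borel_measurable_of_real_test_fun] by auto
    ultimately show ?thesis
      unfolding growth_envelope_function_def by (intro SUP_upper2[of ?g]) auto
  qed
  have index: "Inf (growth_exponents ?M ?X (Lvar_norm \<Omega> p) ?\<Psi> \<epsilon>) = ereal P"
    if \<epsilon>: "0 < \<epsilon>" "\<epsilon> < v\<^sub>0" for \<epsilon>
  proof (rule antisym)
    have "ereal P \<in> growth_exponents ?M ?X (Lvar_norm \<Omega> p) ?\<Psi> \<epsilon>"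
      unfolding growth_exponents_def mem_Collect_eq
    proof (intro conjI exI ballI)
      show "0 < ((measure lebesgue \<Omega> + 1) / P) powr (1 / P)"
        using \<open>0 < P\<close> add_nonneg_pos[OF measure_nonneg[of lebesgue \<Omega>] zero_less_one] by simp
      fix f assume "f \<in> ?X"
      then show "growth_functional ?M ?\<Psi> \<epsilon> (ereal P) f \<le>
          ennreal (((measure lebesgue \<Omega> + 1) / P) powr (1 / P)) * Lvar_norm \<Omega> p f"
        by (intro growth_functional_powr_le \<Omega> p AE_P \<open>0 < P\<close>) (simp add: Lvar_def)
    qed (use \<open>0 < P\<close> in simp)
    then show "Inf (growth_exponents ?M ?X (Lvar_norm \<Omega> p) ?\<Psi> \<epsilon>) \<le> ereal P"
      by (rule Inf_lower)
    show "ereal P \<le> Inf (growth_exponents ?M ?X (Lvar_norm \<Omega> p) ?\<Psi> \<epsilon>)"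
    proof (rule Inf_greatest, rule ccontr)
      fix w assume w: "w \<in> growth_exponents ?M ?X (Lvar_norm \<Omega> p) ?\<Psi> \<epsilon>" "\<not> ereal P \<le> w"
      \<comment> \<open>The index is finite because it lies below \<open>P\<close>, and positive by
        membership in the set of exponents.\<close>
      then obtain v where v: "w = ereal v" "0 < v" "v < P"
        by (cases w) (auto simp: growth_exponents_def)
      with w obtain c where c: "0 < c"
        "\<And>f. f \<in> ?X \<Longrightarrow> growth_functional ?M ?\<Psi> \<epsilon> (ereal v) f \<le> ennreal c * Lvar_norm \<Omega> p f"
        by (auto simp: growth_exponents_def)
      \<comment> \<open>Chosen so that \<open>K * (1 + ln (v\<^sub>0 / \<tau>))\<close> equals
        \<open>A + K * n\<close> for the \<open>\<tau>\<close> used below.\<close>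
      define A where "A = K * (1 + ln (v\<^sub>0 / (\<epsilon> / 2)))"
      have "0 \<le> ln (v\<^sub>0 / (\<epsilon> / 2))" using \<epsilon> by simp
      then have "1 \<le> A" using K mult_mono[of 1 K 1 "1 + ln (v\<^sub>0 / (\<epsilon> / 2))"] by (simp add: A_def)
      have "(n / P) powr (1 / v) \<le> c * (A + K * n) powr (1 / P)" for n :: nat
      proof -
        \<comment> \<open>With \<open>\<delta> = \<epsilon> / 2\<close>, safely inside the open
          interval of integration, this makes \<open>ln (\<delta> / \<tau>)\<close> equal to
          \<open>n\<close>.\<close>
        define \<tau> where "\<tau> = \<epsilon> / 2 * exp (- real n)"
        \<comment> \<open>The scale at which the modular bound is met with equality, so the norm of
          the test function is at most \<open>l\<close>.\<close>
        define l where "l = (A + K * n) powr (1 / P)"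
        let ?f = "\<lambda>x. of_real (test_fun P x\<^sub>0 \<tau> v\<^sub>0 x) :: 'b"
        have \<tau>: "0 < \<tau>" "\<tau> \<le> \<epsilon> / 2" using \<epsilon> by (auto simp: \<tau>_def mult_le_cancel_left1)
        have "1 \<le> A + K * n" using \<open>1 \<le> A\<close> K by (simp add: add_increasing2)
        then have l: "1 \<le> l" "l powr P = A + K * n"
          using \<open>0 < P\<close> by (auto simp: l_def powr_powr ge_one_powr_ge_zero)
        have ln: "ln (\<epsilon> / 2 / \<tau>) = n" "ln (v\<^sub>0 / \<tau>) = ln (v\<^sub>0 / (\<epsilon> / 2)) + n"
          using \<epsilon> v0 by (auto simp: \<tau>_def ln_div ln_mult)
        have f: "modular \<Omega> p (\<lambda>x. ?f x /\<^sub>R l) \<le> 1"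
          using \<tau> \<epsilon> l by (intro test) (auto simp: ln A_def algebra_simps)
        have "ennreal ((n / P) powr (1 / v)) \<le> growth_functional ?M ?\<Psi> \<epsilon> (ereal v) ?f"
          using \<epsilon>
          by (intro growth_functional_test_fun_ge[OF \<Omega>(1) sub \<open>0 < P\<close> v(2) \<tau>, unfolded ln]) auto
        also have "\<dots> \<le> ennreal c * Lvar_norm \<Omega> p ?f"
          using l f borel_measurable_of_real_test_fun[where l = 1] by (intro c(2) X_I[of _ l]) auto
        also have "\<dots> \<le> ennreal c * ennreal l"
          using l f by (intro mult_left_mono Lvar_norm_le) auto
        also have "\<dots> = ennreal (c * l)"
          using c l by (simp add: ennreal_mult)
        finally show ?thesis
          using c l by (simp add: l_def)
      qed
      \<comment> \<open>As \<open>v < P\<close>, the lower bound grows like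
        \<open>n powr (1 / v)\<close>, faster than the norm bound of order
        \<open>n powr (1 / P)\<close>.\<close>
      then show False
        using powr_growth_contradiction[of "1 / P" "1 / v" P A K c] v \<open>0 < P\<close> \<open>1 \<le> A\<close> K
        by (simp add: frac_less2)
    qed
  qed
  have "?\<Psi> C1_differentiable_on {0<..}"
    unfolding C1_differentiable_on_def
  proof (intro exI conjI ballI)
    fix t :: real assume "t \<in> {0<..}"
    then show "(?\<Psi> has_vector_derivative (- 1 / P) * t powr (- 1 / P - 1)) (at t)"
      by (intro has_real_derivative_iff_has_vector_derivative[THEN iffD1]
          has_real_derivative_powr) auto
  qed (use \<open>0 < P\<close> in \<open>auto intro!: continuous_intros\<close>)
  moreover have "antimono_on {0<..} ?\<Psi>"
    using \<open>0 < P\<close> by (auto simp: monotone_on_def intro!: powr_mono2')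
  moreover have "\<exists>\<epsilon>>0. \<exists>A>0. \<exists>B>0. \<forall>t. 0 < t \<and> t < \<epsilon> \<longrightarrow>
        ennreal (A * ?\<Psi> t) \<le> growth_envelope_function ?M ?X (Lvar_norm \<Omega> p) t \<and>
        growth_envelope_function ?M ?X (Lvar_norm \<Omega> p) t \<le> ennreal (B * ?\<Psi> t)"
    using v0 k lower upper
    by (intro exI[of _ "v\<^sub>0 / 2"] exI[of _ "2 powr (- 1 / P) / k"] exI[of _ 2] conjI) auto
  ultimately show ?thesis
    using index v0 \<open>0 < P\<close> unfolding has_growth_envelope_def pm by auto
qed

end
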